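(* Let $A$ be a non-negative reducible square matrix of order $N$ of the form $$A=\begin{pmatrix}A_1&\mathbf{0}\\ \mathbf{0}&A_2\end{pmatrix},$$ where $A_1$ and $A_2$ are irreducible square matrices of order $n_1$ and $n_2$, respectively, with $n_1+n_2=N$. Let $P_A$, $P_{A_1}$ and $P_{A_2}$ be the row-normalizations of $A$, $A_1$ and $A_2$, respectively. Fix $\lambda\in(0,1)$ and let $X(\lambda)=(1-\lambda)(I_N-\lambda P_A)^{-1}$. Then for any personalization vector $\mathbf{v}\in\mathbb{R}^{N\times1}$ with $\|\mathbf{v}\|_1=1$, the recursive sequence $\{\mathbf{x}_k\}_{k\ge0}\subset\mathbb{R}^{N\times1}$ with $\mathbf{x}_0=\mathbf{v}$ defined by $$\mathbf{x}_k^T=\mathbf{x}_{k-1}^TX(\lambda)=\mathbf{v}^TX(\lambda)^k,\qquad k\ge1,$$ converges to the vector $\mathbf{x}^T=(\ \alpha_1\mathbf{c}_1^T\ |\ \alpha_2\mathbf{c}_2^T\ )$ for some $\alpha_1,\alpha_2\ge0$ with $\alpha_1+\alpha_2=1$, where $\mathbf{c}_1\in\mathbb{R}^{n_1\times1}$ and $\mathbf{c}_2\in\mathbb{R}^{n_2\times1}$ are the left-hand Perron vectors of $P_{A_1}$ and $P_{A_2}$, respectively.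
   Context: Vectors are column matrices. A vector or matrix is non-negative (positive) if all its entries are $\ge 0$ ($>0$). $\mathbf{e}=(1,\dots,1)^T$ and $\|\mathbf{x}\|_1=\sum_i|x_i|$. A personalization vector is a positive probability vector: $\mathbf{v}>0$ and $\mathbf{v}^T\mathbf{e}=1$. A square matrix $A$ of order $N\ge 2$ is reducible if there is a permutation matrix $R$ such that $R^TAR=\begin{pmatrix}X&Y\\ \mathbf{0}&Z\end{pmatrix}$ with $X,Z$ square (of order at least 1); otherwise it is irreducible. A $1\times1$ matrix is called irreducible when its entry is nonzero. Row-normalization: for a non-negative matrix $A=(a_{ij})$ with no zero row, $P_A=(p_{ij})$ is given by $p_{ij}=a_{ij}/\sum_k a_{ik}$; it is row-stochastic. Left-hand Perron vector: for a non-negative irreducible matrix $M$, the unique vector $\mathbf{q}$ with $\mathbf{q}^TM=\rho(M)\mathbf{q}^T$, $\mathbf{q}>0$, $\mathbf{q}^T\mathbf{e}=1$, where $\rho(M)$ is the spectral radius. *)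

theory Defs
  imports
    Complex_Main
    "HOL-Combinatorics.Permutations"
    "Jordan_Normal_Form.Gauss_Jordan_Elimination"
    "Jordan_Normal_Form.Spectral_Radius"
begin

text \<open>
  Column vectors are \<^typ>\<open>real vec\<close>. The column vector of a row product \<open>x\<^sup>T M\<close> is obtained
  as the transpose of \<open>M\<close> applied to \<open>x\<close>.
\<close>

definition row_mult :: "real vec \<Rightarrow> real mat \<Rightarrow> real vec" (infixl "\<^sup>T*\<^sub>m" 70) where
  "x \<^sup>T*\<^sub>m M = transpose_mat M *\<^sub>v x"

definition norm1_vec :: "real vec \<Rightarrow> real" where
  "norm1_vec x = (\<Sum>i<dim_vec x. \<bar>x $ i\<bar>)"

definition ones_vec :: "nat \<Rightarrow> real vec" where
  "ones_vec n = vec n (\<lambda>_. 1)"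

text \<open>The library order \<open><\<close> on vectors is not the entrywise strict order.\<close>

definition positive_vec :: "real vec \<Rightarrow> bool" where
  "positive_vec x \<longleftrightarrow> (\<forall>i<dim_vec x. 0 < x $ i)"

text \<open>By contrast, \<open>\<le>\<close> on matrices is the entrywise order, between matrices of equal dimensions.\<close>

definition nonneg_mat :: "real mat \<Rightarrow> bool" where
  "nonneg_mat A \<longleftrightarrow> 0\<^sub>m (dim_row A) (dim_col A) \<le> A"

definition personalization_vec :: "real vec \<Rightarrow> bool" where
  "personalization_vec v \<longleftrightarrow> positive_vec v \<and> v \<bullet> ones_vec (dim_vec v) = 1"

definition permutation_mat :: "real mat \<Rightarrow> bool" where
  "permutation_mat R \<longleftrightarrow> (\<exists>p. p permutes {..<dim_row R} \<and>
     R = mat (dim_row R) (dim_row R) (\<lambda>(i, j). if i = p j then 1 else 0))"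

definition reducible_mat :: "real mat \<Rightarrow> bool" where
  "reducible_mat A \<longleftrightarrow> square_mat A \<and>
     (\<exists>R X Y Z r s. r \<ge> 1 \<and> s \<ge> 1 \<and> r + s = dim_row A
        \<and> R \<in> carrier_mat (dim_row A) (dim_row A) \<and> permutation_mat R
        \<and> X \<in> carrier_mat r r \<and> Y \<in> carrier_mat r s \<and> Z \<in> carrier_mat s s
        \<and> transpose_mat R * A * R = four_block_mat X Y (0\<^sub>m s r) Z)"

text \<open>Order 1 is treated separately; the empty matrix is not irreducible.\<close>

definition irreducible_mat :: "real mat \<Rightarrow> bool" where
  "irreducible_mat A \<longleftrightarrow> square_mat A \<and>
     (dim_row A = 1 \<and> A $$ (0, 0) \<noteq> 0 \<or> dim_row A \<ge> 2 \<and> \<not> reducible_mat A)"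

text \<open>Only meaningful if no row sum vanishes.\<close>

definition row_normalize :: "real mat \<Rightarrow> real mat" where
  "row_normalize A = mat (dim_row A) (dim_col A)
     (\<lambda>(i, j). A $$ (i, j) / (\<Sum>k<dim_col A. A $$ (i, k)))"

definition rho :: "real mat \<Rightarrow> real" where
  "rho M = spectral_radius (map_mat complex_of_real M)"

definition is_left_perron_vec :: "real mat \<Rightarrow> real vec \<Rightarrow> bool" where
  "is_left_perron_vec M q \<longleftrightarrow> q \<in> carrier_vec (dim_row M)
     \<and> q \<^sup>T*\<^sub>m M = rho M \<cdot>\<^sub>v q \<and> positive_vec q \<and> q \<bullet> ones_vec (dim_row M) = 1"

definition left_perron_vec :: "real mat \<Rightarrow> real vec" where
  "left_perron_vec M = (THE q. is_left_perron_vec M q)"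

text \<open>
  \<^const>\<open>mat_inverse\<close> is partial (an option); it is the two-sided inverse whenever the
  matrix is invertible, as \<open>I - lam P\<close> is for row-stochastic \<open>P\<close> and \<open>0 < lam < 1\<close>.
\<close>

definition X_mat :: "real mat \<Rightarrow> real \<Rightarrow> real mat" where
  "X_mat A lam =
     (1 - lam) \<cdot>\<^sub>m the (mat_inverse (1\<^sub>m (dim_row A) - lam \<cdot>\<^sub>m row_normalize A))"

definition converges_vec :: "(nat \<Rightarrow> real vec) \<Rightarrow> real vec \<Rightarrow> bool" where
  "converges_vec x l \<longleftrightarrow> (\<forall>k. dim_vec (x k) = dim_vec l)
     \<and> (\<lambda>k. norm1_vec (x k - l)) \<longlonglongrightarrow> 0"

end

theory Submission
  imports Defs
begin

text \<open>
  The recursion says that \<open>z = x\<^sub>k\<close> solves \<open>z\<^sup>T = lam z\<^sup>T P + (1 - lam) y\<^sup>T\<close> with \<open>y = x\<^bsub>k-1\<^esub>\<close>, and this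
  equation splits along the two diagonal blocks of \<open>P\<close>. For stochastic \<open>P\<close> it preserves the sum of
  the entries and does not increase the 1-norm. For irreducible \<open>P\<close> the resolvent has only positive
  entries, since the support of each of its rows is closed under the edges of \<open>P\<close>; hence it strictly
  contracts vectors of sum zero (Dobrushin). So on each block the sequence converges to the invariant
  distribution times the initial mass \<open>\<alpha>\<close> of that block.
\<close>

section \<open>The resolvent equation as a linear relation\<close>

text \<open>A relation between datum \<open>y\<close> and solution \<open>z\<close> avoids
  mentioning an inverse matrix. With plain functions on indices, a diagonal block is treated by
  merely shifting the index.\<close>

definition resolvent_step :: "nat \<Rightarrow> (nat \<Rightarrow> nat \<Rightarrow> real) \<Rightarrow> real \<Rightarrow> (nat \<Rightarrow> real) \<Rightarrow> (nat \<Rightarrow> real) \<Rightarrow> bool"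
  where "resolvent_step n p lam y z \<longleftrightarrow>
    (\<forall>j<n. z j = lam * (\<Sum>i<n. z i * p i j) + (1 - lam) * y j)"

lemma resolvent_stepD:
  "resolvent_step n p lam y z \<Longrightarrow> j < n \<Longrightarrow> z j = lam * (\<Sum>i<n. z i * p i j) + (1 - lam) * y j"
  unfolding resolvent_step_def by blast

lemma resolvent_step_cong:
  assumes "resolvent_step n p lam y z" "\<And>j. j < n \<Longrightarrow> y j = y' j"
  shows "resolvent_step n p lam y' z"
  unfolding resolvent_step_def
proof (intro allI impI)
  fix j assume "j < n"
  show "z j = lam * (\<Sum>i<n. z i * p i j) + (1 - lam) * y' j"
    unfolding assms(2)[OF \<open>j < n\<close>, symmetric] by (rule resolvent_stepD[OF assms(1) \<open>j < n\<close>])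
qed

lemma resolvent_step_diff:
  assumes "resolvent_step n p lam y z" "resolvent_step n p lam y' z'"
  shows "resolvent_step n p lam (\<lambda>i. y i - y' i) (\<lambda>i. z i - z' i)"
  unfolding resolvent_step_def
proof (intro allI impI)
  fix j assume "j < n"
  then show "z j - z' j = lam * (\<Sum>i<n. (z i - z' i) * p i j) + (1 - lam) * (y j - y' j)"
    unfolding resolvent_stepD[OF assms(1) \<open>j < n\<close>] resolvent_stepD[OF assms(2) \<open>j < n\<close>]
    by (simp add: left_diff_distrib sum_subtractf right_diff_distrib)
qed

text \<open>Linearity in the datum; it serves to assemble the solution for an arbitrary datum from
  the solutions for unit vectors.\<close>

lemma resolvent_step_sum:
  assumes "\<And>i. i \<in> I \<Longrightarrow> resolvent_step n p lam (y i) (z i)"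
  shows "resolvent_step n p lam (\<lambda>j. \<Sum>i\<in>I. a i * y i j) (\<lambda>j. \<Sum>i\<in>I. a i * z i j)"
  unfolding resolvent_step_def
proof (intro allI impI)
  fix j assume "j < n"
  have "(\<Sum>i\<in>I. a i * z i j) =
      (\<Sum>i\<in>I. a i * (lam * (\<Sum>k<n. z i k * p k j) + (1 - lam) * y i j))"
    by (rule sum.cong[OF refl]) (simp only: resolvent_stepD[OF assms \<open>j < n\<close>, symmetric])
  also have "\<dots> = lam * (\<Sum>i\<in>I. \<Sum>k<n. a i * z i k * p k j) + (1 - lam) * (\<Sum>i\<in>I. a i * y i j)"
    by (simp add: sum.distrib sum_subtractf sum_distrib_left algebra_simps)
  also have "(\<Sum>i\<in>I. \<Sum>k<n. a i * z i k * p k j) = (\<Sum>k<n. (\<Sum>i\<in>I. a i * z i k) * p k j)"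
    by (subst sum.swap) (simp add: sum_distrib_right)
  finally show "(\<Sum>i\<in>I. a i * z i j) =
      lam * (\<Sum>k<n. (\<Sum>i\<in>I. a i * z i k) * p k j) + (1 - lam) * (\<Sum>i\<in>I. a i * y i j)" .
qed

text \<open>Since \<open>lam + (1 - lam) = 1\<close>, a left fixed vector of \<open>p\<close> is its
  own solution. Its multiples are the candidates for the limit of the iteration.\<close>

lemma resolvent_step_invariant:
  assumes "\<And>j. j < n \<Longrightarrow> (\<Sum>i<n. q i * p i j) = q j"
  shows "resolvent_step n p lam (\<lambda>i. a * q i) (\<lambda>i. a * q i)"
  unfolding resolvent_step_def
proof (intro allI impI)
  fix j assume "j < n"
  have "(\<Sum>i<n. a * q i * p i j) = a * q j"
    unfolding assms[OF \<open>j < n\<close>, symmetric] by (simp add: sum_distrib_left mult.assoc)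
  then show "a * q j = lam * (\<Sum>i<n. a * q i * p i j) + (1 - lam) * (a * q j)"
    by (simp only:) (simp add: algebra_simps)
qed

section \<open>Stochastic kernels: conservation of mass and norm bounds\<close>

locale stochastic =
  fixes n :: nat and p :: "nat \<Rightarrow> nat \<Rightarrow> real"
  assumes nonneg: "\<And>i j. i < n \<Longrightarrow> j < n \<Longrightarrow> 0 \<le> p i j"
    and row_sum: "\<And>i. i < n \<Longrightarrow> (\<Sum>j<n. p i j) = 1"
begin

text \<open>Exchanging the sums collects the row sums, all equal to 1.\<close>

lemma sum_apply: "(\<Sum>j<n. \<Sum>i<n. z i * p i j) = (\<Sum>i<n. z i)"
proof -
  have "(\<Sum>j<n. \<Sum>i<n. z i * p i j) = (\<Sum>i<n. z i * (\<Sum>j<n. p i j))"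
    by (subst sum.swap) (simp add: sum_distrib_left)
  then show ?thesis by (simp add: row_sum)
qed

lemma norm_apply_le: "(\<Sum>j<n. \<bar>\<Sum>i<n. z i * p i j\<bar>) \<le> (\<Sum>i<n. \<bar>z i\<bar>)"
proof -
  have "(\<Sum>j<n. \<bar>\<Sum>i<n. z i * p i j\<bar>) \<le> (\<Sum>j<n. \<Sum>i<n. \<bar>z i\<bar> * p i j)"
    by (intro sum_mono order_trans[OF sum_abs]) (simp add: abs_mult nonneg)
  then show ?thesis by (simp add: sum_apply)
qed

context
  fixes lam :: real
  assumes lam: "0 < lam" "lam < 1"
begin

text \<open>Summing the equation over \<open>j\<close> and applying conservation of mass under
  \<open>p\<close> leaves \<open>1 - lam\<close> times both totals, a factor that is
  positive.\<close>

lemma resolvent_sum: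
  assumes "resolvent_step n p lam y z"
  shows "(\<Sum>i<n. z i) = (\<Sum>i<n. y i)"
proof -
  have "(\<Sum>i<n. z i) = (\<Sum>j<n. lam * (\<Sum>i<n. z i * p i j) + (1 - lam) * y j)"
    by (rule sum.cong[OF refl]) (simp only: lessThan_iff resolvent_stepD[OF assms, symmetric])
  also have "\<dots> = lam * (\<Sum>i<n. z i) + (1 - lam) * (\<Sum>i<n. y i)"
    by (simp only: sum.distrib sum_apply flip: sum_distrib_left)
  finally have "(1 - lam) * (\<Sum>i<n. z i) = (1 - lam) * (\<Sum>i<n. y i)"
    by (simp add: algebra_simps)
  then show ?thesis using lam by simp
qed

text \<open>The triangle inequality bounds the norm of \<open>z\<close> by \<open>lam\<close> times
  itself plus \<open>1 - lam\<close> times the norm of \<open>y\<close>; the first term is absorbed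
  on the left.\<close>

lemma resolvent_norm_le:
  assumes "resolvent_step n p lam y z"
  shows "(\<Sum>i<n. \<bar>z i\<bar>) \<le> (\<Sum>i<n. \<bar>y i\<bar>)"
proof -
  have "(\<Sum>i<n. \<bar>z i\<bar>) = (\<Sum>j<n. \<bar>lam * (\<Sum>i<n. z i * p i j) + (1 - lam) * y j\<bar>)"
    by (rule sum.cong[OF refl]) (simp only: lessThan_iff resolvent_stepD[OF assms, symmetric])
  also have "\<dots> \<le> (\<Sum>j<n. lam * \<bar>\<Sum>i<n. z i * p i j\<bar> + (1 - lam) * \<bar>y j\<bar>)"
    using lam by (intro sum_mono order_trans[OF abs_triangle_ineq]) (simp add: abs_mult)
  also have "\<dots> = lam * (\<Sum>j<n. \<bar>\<Sum>i<n. z i * p i j\<bar>) + (1 - lam) * (\<Sum>i<n. \<bar>y i\<bar>)"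
    by (simp only: sum.distrib flip: sum_distrib_left)
  also have "\<dots> \<le> lam * (\<Sum>i<n. \<bar>z i\<bar>) + (1 - lam) * (\<Sum>i<n. \<bar>y i\<bar>)"
    using lam norm_apply_le[of z] by simp
  finally have "(1 - lam) * (\<Sum>i<n. \<bar>z i\<bar>) \<le> (1 - lam) * (\<Sum>i<n. \<bar>y i\<bar>)"
    by (simp add: algebra_simps)
  then show ?thesis using lam by simp
qed

text \<open>For a nonnegative datum the norm bound and conservation of mass give
  \<open>sum |z| \<le> sum y = sum z\<close>, so no \<open>z i\<close> can differ from its absolute
  value. No Neumann series is involved.\<close>

lemma resolvent_nonneg:
  assumes "resolvent_step n p lam y z" "\<And>i. i < n \<Longrightarrow> 0 \<le> y i" "i < n"
  shows "0 \<le> z i"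
proof -
  have "(\<Sum>i<n. \<bar>z i\<bar>) \<le> (\<Sum>i<n. z i)"
    using resolvent_norm_le[OF assms(1)] resolvent_sum[OF assms(1)] assms(2) by simp
  then have "(\<Sum>i<n. \<bar>z i\<bar> - z i) = 0"
    by (intro antisym) (auto simp: sum_subtractf intro: sum_mono)
  then have "\<forall>i\<in>{..<n}. \<bar>z i\<bar> - z i = 0"
    by (subst (asm) sum_nonneg_eq_0_iff) auto
  then have "\<bar>z i\<bar> = z i" using \<open>i < n\<close> by auto
  then show ?thesis by (metis abs_ge_zero)
qed

text \<open>The difference of two solutions has datum zero, hence norm zero.\<close>

lemma resolvent_unique:
  assumes "resolvent_step n p lam y z" "resolvent_step n p lam y z'" "i < n"
  shows "z i = z' i"
proof -
  have "resolvent_step n p lam (\<lambda>_. 0) (\<lambda>i. z i - z' i)"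
    using resolvent_step_diff[OF assms(1,2)] by simp
  from resolvent_norm_le[OF this] have "(\<Sum>i<n. \<bar>z i - z' i\<bar>) = 0"
    by (intro antisym) (auto intro: sum_nonneg)
  then show ?thesis using \<open>i < n\<close> by (subst (asm) sum_nonneg_eq_0_iff) auto
qed

end

section \<open>Existence of the inverse matrix\<close>

text \<open>A left null vector of \<open>I - lam P\<close> would solve the resolvent equation with
  datum zero, and uniqueness forces it to vanish. This is the bridge from \<open>mat_inverse\<close>
  to the relation \<open>resolvent_step\<close>.\<close>

lemma mat_inverse_exists:
  assumes lam: "0 < lam" "lam < 1"
    and P: "P \<in> carrier_mat n n" "\<And>i j. i < n \<Longrightarrow> j < n \<Longrightarrow> P $$ (i, j) = p i j"
  obtains B where "mat_inverse (1\<^sub>m n - lam \<cdot>\<^sub>m P) = Some B" "B \<in> carrier_mat n n"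
    "\<And>y. y \<in> carrier_vec n \<Longrightarrow>
      resolvent_step n p lam (($) y) (($) (y \<^sup>T*\<^sub>m ((1 - lam) \<cdot>\<^sub>m B)))"
proof -
  let ?C = "1\<^sub>m n - lam \<cdot>\<^sub>m P"
  have C: "?C \<in> carrier_mat n n" using P by auto
  have CT: "transpose_mat ?C \<in> carrier_mat n n" using C by (rule transpose_carrier_mat[THEN iffD2])
  have entry: "(transpose_mat ?C *\<^sub>v w) $ j = w $ j - lam * (\<Sum>i<n. w $ i * p i j)"
    if "w \<in> carrier_vec n" "j < n" for w j
  proof -
    have "(transpose_mat ?C *\<^sub>v w) $ j = (\<Sum>i<n. ((if i = j then 1 else 0) - lam * p i j) * w $ i)"
      using that P C by (auto simp: scalar_prod_def atLeast0LessThan intro!: sum.cong)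
    also have "\<dots> = (\<Sum>i<n. if i = j then w $ i else 0) - lam * (\<Sum>i<n. w $ i * p i j)"
      unfolding sum_distrib_left sum_subtractf[symmetric]
      by (intro sum.cong) (auto simp: algebra_simps)
    finally show ?thesis using that by simp
  qed
  have "det (transpose_mat ?C) \<noteq> 0"
  proof
    assume "det (transpose_mat ?C) = 0"
    with det_0_iff_vec_prod_zero_field[OF CT] obtain w where
      w: "w \<in> carrier_vec n" "w \<noteq> 0\<^sub>v n" "transpose_mat ?C *\<^sub>v w = 0\<^sub>v n"
      by metis
    have "resolvent_step n p lam (\<lambda>_. 0) (($) w)"
      unfolding resolvent_step_def
    proof (intro allI impI)
      fix j assume "j < n"
      with entry[OF w(1) this] show "w $ j = lam * (\<Sum>i<n. w $ i * p i j) + (1 - lam) * 0"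
        unfolding w(3) by simp
    qed
    moreover have "resolvent_step n p lam (\<lambda>_. 0) (\<lambda>_. 0)"
      by (simp add: resolvent_step_def)
    ultimately have "\<And>i. i < n \<Longrightarrow> w $ i = 0"
      using resolvent_unique[OF lam] by blast
    then have "w = 0\<^sub>v n" using w(1) by (intro eq_vecI) auto
    with w(2) show False ..
  qed
  then have "det ?C \<noteq> 0" by (simp only: det_transpose[OF C] not_False_eq_True)
  \<comment> \<open>\<open>mat_inverse\<close> yields \<open>None\<close> only for non-units of the
    matrix ring, whereas a nonzero determinant makes \<open>?C\<close> a unit.\<close>
  from det_non_zero_imp_unit[OF C this, of "()"] obtain B where B: "mat_inverse ?C = Some B"
    using mat_inverse(1)[OF C, of "()"] by (metis option.exhaust)
  note inv = mat_inverse(2)[OF C B]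
  show thesis
  proof (rule that[OF B])
    show "B \<in> carrier_mat n n" using inv by auto
    fix y :: "real vec" assume y: "y \<in> carrier_vec n"
    define w where "w = y \<^sup>T*\<^sub>m ((1 - lam) \<cdot>\<^sub>m B)"
    have D: "transpose_mat ((1 - lam) \<cdot>\<^sub>m B) \<in> carrier_mat n n" using inv by simp
    have w: "w \<in> carrier_vec n" using D y unfolding w_def row_mult_def by (rule mult_mat_vec_carrier)
    \<comment> \<open>Transposition reverses the product, so the inverse property enters in the
      order \<open>B * ?C = 1\<close>.\<close>
    have "transpose_mat ?C *\<^sub>v w = transpose_mat ((1 - lam) \<cdot>\<^sub>m B * ?C) *\<^sub>v y"
      unfolding w_def row_mult_def using inv
      by (subst transpose_mult[OF _ C]) (auto simp: assoc_mult_mat_vec[OF CT D y])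
    also have "(1 - lam) \<cdot>\<^sub>m B * ?C = (1 - lam) \<cdot>\<^sub>m 1\<^sub>m n"
      using inv C by (metis mult_smult_assoc_mat)
    finally have eq: "transpose_mat ?C *\<^sub>v w = transpose_mat ((1 - lam) \<cdot>\<^sub>m 1\<^sub>m n) *\<^sub>v y" .
    have rhs: "(transpose_mat ?C *\<^sub>v w) $ j = (1 - lam) * y $ j" if "j < n" for j
    proof -
      have "(transpose_mat ?C *\<^sub>v w) $ j = (\<Sum>i<n. (1 - lam) * (if i = j then 1 else 0) * y $ i)"
        unfolding eq using that y by (simp add: scalar_prod_def atLeast0LessThan)
      also have "\<dots> = (\<Sum>i<n. if i = j then (1 - lam) * y $ i else 0)"
        by (intro sum.cong) auto
      finally show ?thesis using that by simp
    qed
    show "resolvent_step n p lam (($) y) (($) (y \<^sup>T*\<^sub>m ((1 - lam) \<cdot>\<^sub>m B)))"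
      unfolding w_def[symmetric] resolvent_step_def
    proof (intro allI impI)
      fix j assume "j < n"
      show "w $ j = lam * (\<Sum>i<n. w $ i * p i j) + (1 - lam) * y $ j"
        using entry[OF w \<open>j < n\<close>] rhs[OF \<open>j < n\<close>] by linarith
    qed
  qed
qed

end

section \<open>Irreducible kernels: positivity, invariant distribution, contraction\<close>

text \<open>\<open>connected\<close> is irreducibility in cut form, that is, strong connectedness of
  the graph of positive entries. For \<open>n = 1\<close> it holds vacuously.\<close>

locale irreducible_stochastic = stochastic +
  assumes dim_pos: "0 < n"
    and connected: "\<And>S. S \<subseteq> {..<n} \<Longrightarrow> S \<noteq> {} \<Longrightarrow> S \<noteq> {..<n} \<Longrightarrow>
      \<exists>i\<in>S. \<exists>j\<in>{..<n} - S. 0 < p i j"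
begin

text \<open>An edge from \<open>i\<close> to \<open>l\<close> with \<open>u i > 0\<close> forces
  \<open>u l > 0\<close>, so no edge leaves the support of \<open>u\<close> and
  \<open>connected\<close> makes it everything. The weight \<open>c\<close> covers both invariant
  vectors (\<open>c = 1\<close>) and resolvent rows (\<open>c = lam\<close>).\<close>

lemma superinvariant_pos:
  assumes "0 < c" and u: "\<And>i. i < n \<Longrightarrow> 0 \<le> u i"
    and super: "\<And>j. j < n \<Longrightarrow> c * (\<Sum>i<n. u i * p i j) \<le> u j"
    and "k < n" "0 < u k" "j < n"
  shows "0 < u j"
proof (rule ccontr)
  define S where "S = {i. i < n \<and> 0 < u i}"
  assume "\<not> 0 < u j"
  then have "S \<subseteq> {..<n}" "S \<noteq> {}" "S \<noteq> {..<n}" using assms(4-6) by (auto simp: S_def)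
  from connected[OF this] obtain i l where il: "i < n" "0 < u i" "l < n" "\<not> 0 < u l" "0 < p i l"
    by (auto simp: S_def)
  have "0 < u i * p i l" using il by simp
  also have "\<dots> \<le> (\<Sum>i<n. u i * p i l)"
    using il by (intro member_le_sum) (auto intro: mult_nonneg_nonneg u nonneg)
  finally have "0 < c * (\<Sum>i<n. u i * p i l)" using \<open>0 < c\<close> by simp
  with super[OF \<open>l < n\<close>] il(4) show False by linarith
qed

text \<open>Row sums 1 put the all-ones vector into the kernel of \<open>P - I\<close>. The
  transpose is then singular too, which gives a nonzero left fixed vector; its absolute value,
  normalized to mass 1, is the required distribution.\<close>

lemma invariant_distribution_exists:
  obtains q where "\<And>j. j < n \<Longrightarrow> (\<Sum>i<n. q i * p i j) = q j" "\<And>j. j < n \<Longrightarrow> 0 < q j"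
    "(\<Sum>i<n. q i) = 1"
proof -
  define D where "D = mat n n (\<lambda>(i, j). p i j - (if i = j then 1 else 0))"
  have D: "D \<in> carrier_mat n n" by (simp add: D_def)
  have DT: "transpose_mat D \<in> carrier_mat n n" using D by simp
  have "D *\<^sub>v ones_vec n = 0\<^sub>v n"
    by (rule eq_vecI)
      (auto simp: D_def ones_vec_def scalar_prod_def atLeast0LessThan sum_subtractf row_sum)
  moreover have "ones_vec n \<noteq> 0\<^sub>v n"
    using dim_pos by (metis index_vec index_zero_vec(1) ones_vec_def zero_neq_one)
  moreover have "ones_vec n \<in> carrier_vec n" by (simp add: ones_vec_def)
  ultimately have "det D = 0" using det_0_iff_vec_prod_zero_field[OF D] by metis
  then have "det (transpose_mat D) = 0" by (simp only: det_transpose[OF D])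
  with det_0_iff_vec_prod_zero_field[OF DT] obtain w
    where w: "w \<in> carrier_vec n" "w \<noteq> 0\<^sub>v n" "transpose_mat D *\<^sub>v w = 0\<^sub>v n"
    by metis
  have inv: "(\<Sum>i<n. w $ i * p i j) = w $ j" if "j < n" for j
  proof -
    have "0 = (transpose_mat D *\<^sub>v w) $ j" using w(3) that by simp
    also have "\<dots> = (\<Sum>i<n. w $ i * p i j - (if i = j then w $ i else 0))"
      using that w(1)
      by (auto simp: D_def scalar_prod_def atLeast0LessThan algebra_simps intro!: sum.cong)
    finally show ?thesis using that by (simp add: sum_subtractf)
  qed
  \<comment> \<open>\<open>u \<le> u P\<close> entrywise with equal total mass, hence equality.\<close>
  define u where "u i = \<bar>w $ i\<bar>" for i
  have le: "u j \<le> (\<Sum>i<n. u i * p i j)" if "j < n" for j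
  proof -
    have "u j = \<bar>\<Sum>i<n. w $ i * p i j\<bar>" using inv[OF that] by (simp add: u_def)
    also have "\<dots> \<le> (\<Sum>i<n. u i * p i j)"
      using that by (intro order_trans[OF sum_abs] sum_mono) (simp add: u_def abs_mult nonneg)
    finally show ?thesis .
  qed
  have "(\<Sum>j<n. (\<Sum>i<n. u i * p i j) - u j) = 0"
    by (simp add: sum_subtractf sum_apply)
  then have "\<forall>j\<in>{..<n}. (\<Sum>i<n. u i * p i j) - u j = 0"
    by (subst (asm) sum_nonneg_eq_0_iff) (auto simp: le)
  then have inv_u: "(\<Sum>i<n. u i * p i j) = u j" if "j < n" for j using that by force
  obtain k where k: "k < n" "w $ k \<noteq> 0"
    using w(1,2) by (metis carrier_vecD eq_vecI index_zero_vec)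
  \<comment> \<open>Invariance is superinvariance with weight 1, and \<open>k\<close> supplies one
    positive entry.\<close>
  have pos: "0 < u j" if "j < n" for j
    by (rule superinvariant_pos[of 1 u k]) (use that k inv_u in \<open>auto simp: u_def\<close>)
  then have spos: "0 < (\<Sum>i<n. u i)" using dim_pos by (intro sum_pos) auto
  show thesis
  proof (rule that[of "\<lambda>j. u j / (\<Sum>i<n. u i)"])
    fix j assume "j < n"
    show "(\<Sum>i<n. u i / (\<Sum>i<n. u i) * p i j) = u j / (\<Sum>i<n. u i)"
      unfolding inv_u[OF \<open>j < n\<close>, symmetric] by (simp add: sum_divide_distrib)
    show "0 < u j / (\<Sum>i<n. u i)" using pos \<open>j < n\<close> spos by simp
  next
    show "(\<Sum>j<n. u j / (\<Sum>i<n. u i)) = 1"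
      using spos by (simp flip: sum_divide_distrib)
  qed
qed

text \<open>Dobrushin's argument: all resolvent entries are at least some \<open>e > 0\<close>. On
  data of sum zero, subtracting \<open>e\<close> from every entry changes nothing, and the
  nonnegative matrix that remains has row sums \<open>1 - n * e\<close>.\<close>

lemma resolvent_contraction:
  assumes lam: "0 < lam" "lam < 1"
  obtains c where "0 \<le> c" "c < 1"
    "\<And>y z. resolvent_step n p lam y z \<Longrightarrow> (\<Sum>i<n. y i) = 0 \<Longrightarrow>
      (\<Sum>i<n. \<bar>z i\<bar>) \<le> c * (\<Sum>i<n. \<bar>y i\<bar>)"
proof -
  define P where "P = mat n n (\<lambda>(i, j). p i j)"
  have "P \<in> carrier_mat n n" "\<And>i j. i < n \<Longrightarrow> j < n \<Longrightarrow> P $$ (i, j) = p i j"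
    by (auto simp: P_def)
  from mat_inverse_exists[OF lam this] obtain B where
    B: "\<And>y. y \<in> carrier_vec n \<Longrightarrow>
      resolvent_step n p lam (($) y) (($) (y \<^sup>T*\<^sub>m ((1 - lam) \<cdot>\<^sub>m B)))" by blast
  \<comment> \<open>\<open>d i\<close> is the unit datum at \<open>i\<close> and \<open>G i\<close>
    its solution, that is, row \<open>i\<close> of the resolvent
    \<open>(1 - lam) (I - lam P)^-1\<close>.\<close>
  define d where "d i j = (unit_vec n i :: real vec) $ j" for i j :: nat
  define G where "G i j = (unit_vec n i \<^sup>T*\<^sub>m ((1 - lam) \<cdot>\<^sub>m B)) $ j" for i j :: nat
  have d: "d i j = (if i = j then 1 else 0)" if "i < n" "j < n" for i j
    using that by (auto simp: d_def)
  have step: "resolvent_step n p lam (d i) (G i)" for i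
    using B[of "unit_vec n i"] by (simp add: d_def[abs_def] G_def[abs_def])
  have nn: "0 \<le> G i j" if "i < n" "j < n" for i j
    using resolvent_nonneg[OF lam step[of i] _ that(2)] d that(1) by auto
  have pos: "0 < G i j" if ij: "i < n" "j < n" for i j
  proof (rule superinvariant_pos[of lam "G i" i j])
    \<comment> \<open>Dropping the nonnegative datum from the equation leaves superinvariance with
      weight \<open>lam\<close>.\<close>
    show "lam * (\<Sum>k<n. G i k * p k l) \<le> G i l" if "l < n" for l
      using resolvent_stepD[OF step that, of i] d[OF ij(1) that] lam by simp
    \<comment> \<open>At the diagonal the datum contributes \<open>1 - lam > 0\<close>, the seed
      from which positivity spreads along the row.\<close>
    have "0 \<le> lam * (\<Sum>k<n. G i k * p k i)"
      using lam ij by (intro mult_nonneg_nonneg sum_nonneg) (auto intro: nn nonneg)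
    then show "0 < G i i"
      using resolvent_stepD[OF step ij(1), of i] d[OF ij(1) ij(1)] lam by simp
  qed (use nn lam ij in auto)
  define e where "e = Min ((\<lambda>(i, j). G i j) ` ({..<n} \<times> {..<n}))"
  have "e \<in> (\<lambda>(i, j). G i j) ` ({..<n} \<times> {..<n})"
    unfolding e_def using dim_pos by (intro Min_in) auto
  then have "0 < e" using pos by auto
  have e_le: "e \<le> G i j" if "i < n" "j < n" for i j
    unfolding e_def using that by (intro Min_le) auto
  have G_sum: "(\<Sum>j<n. G i j) = 1" if "i < n" for i
  proof -
    have "(\<Sum>j<n. G i j) = (\<Sum>j<n. d i j)" by (rule resolvent_sum[OF lam step])
    also have "\<dots> = (\<Sum>j<n. if i = j then 1 else 0)" using that d by (intro sum.cong) auto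
    finally show ?thesis using that by simp
  qed
  show thesis
  proof (rule that[of "1 - real n * e"])
    \<comment> \<open>The \<open>n\<close> entries of row 0 are each at least \<open>e\<close> and
      sum to 1.\<close>
    have "real n * e \<le> (\<Sum>j<n. G 0 j)"
      using sum_mono[of "{..<n}" "\<lambda>_. e" "G 0"] e_le[OF dim_pos] by simp
    then show "0 \<le> 1 - real n * e" using G_sum[OF dim_pos] by simp
    show "1 - real n * e < 1" using \<open>0 < e\<close> dim_pos by simp
    fix y z assume yz: "resolvent_step n p lam y z" and y0: "(\<Sum>i<n. y i) = 0"
    \<comment> \<open>The combination of the rows with weights \<open>y i\<close> has datum
      \<open>y\<close>, so uniqueness identifies it with \<open>z\<close>.\<close>
    have "resolvent_step n p lam (\<lambda>j. \<Sum>i<n. y i * d i j) (\<lambda>j. \<Sum>i<n. y i * G i j)"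
      by (rule resolvent_step_sum) (rule step)
    then have "resolvent_step n p lam y (\<lambda>j. \<Sum>i<n. y i * G i j)"
    proof (rule resolvent_step_cong)
      fix j assume "j < n"
      have "(\<Sum>i<n. y i * d i j) = (\<Sum>i<n. if i = j then y i else 0)"
        using \<open>j < n\<close> d by (intro sum.cong) auto
      then show "(\<Sum>i<n. y i * d i j) = y j" using \<open>j < n\<close> by simp
    qed
    note z_eq = resolvent_unique[OF lam yz this]
    have "(\<Sum>j<n. \<bar>z j\<bar>) \<le> (\<Sum>j<n. \<Sum>i<n. \<bar>y i\<bar> * (G i j - e))"
    proof (rule sum_mono)
      fix j assume "j \<in> {..<n}"
      then have "j < n" by simp
      \<comment> \<open>The subtracted part is \<open>e\<close> times the sum of \<open>y\<close>,
        which is zero.\<close>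
      have "z j = (\<Sum>i<n. y i * (G i j - e))"
        using z_eq[OF \<open>j < n\<close>] y0
        by (simp add: right_diff_distrib sum_subtractf flip: sum_distrib_right)
      also have "\<bar>\<dots>\<bar> \<le> (\<Sum>i<n. \<bar>y i\<bar> * (G i j - e))"
        using \<open>j < n\<close> e_le by (intro order_trans[OF sum_abs] sum_mono) (simp add: abs_mult)
      finally show "\<bar>z j\<bar> \<le> (\<Sum>i<n. \<bar>y i\<bar> * (G i j - e))" .
    qed
    also have "\<dots> = (\<Sum>i<n. \<bar>y i\<bar> * (\<Sum>j<n. G i j - e))"
      by (subst sum.swap) (simp add: sum_distrib_left)
    also have "\<dots> = (\<Sum>i<n. \<bar>y i\<bar> * (1 - real n * e))"
      by (intro sum.cong) (auto simp: sum_subtractf G_sum)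
    finally show "(\<Sum>j<n. \<bar>z j\<bar>) \<le> (1 - real n * e) * (\<Sum>i<n. \<bar>y i\<bar>)"
      by (simp add: sum_distrib_left mult.commute)
  qed
qed

text \<open>The difference has sum zero and is its own resolvent solution, so a contraction with
  \<open>c < 1\<close> annihilates it. The parameter 1/2 is an arbitrary choice in the open unit
  interval.\<close>

lemma invariant_unique:
  assumes q: "\<And>j. j < n \<Longrightarrow> (\<Sum>i<n. q i * p i j) = q j"
    and q': "\<And>j. j < n \<Longrightarrow> (\<Sum>i<n. q' i * p i j) = q' j"
    and sums: "(\<Sum>i<n. q i) = (\<Sum>i<n. q' i)" and "j < n"
  shows "q j = q' j"
proof -
  obtain c where c: "c < 1" and
    contr: "\<And>y z. resolvent_step n p (1/2) y z \<Longrightarrow> (\<Sum>i<n. y i) = 0 \<Longrightarrow>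
      (\<Sum>i<n. \<bar>z i\<bar>) \<le> c * (\<Sum>i<n. \<bar>y i\<bar>)"
    by (rule resolvent_contraction[of "1/2"]) auto
  define D where "D = (\<Sum>i<n. \<bar>q i - q' i\<bar>)"
  have "resolvent_step n p (1/2) (\<lambda>i. q i - q' i) (\<lambda>i. q i - q' i)"
    using resolvent_step_diff[OF resolvent_step_invariant[of n q p _ 1, OF q]
        resolvent_step_invariant[of n q' p _ 1, OF q']] by simp
  from contr[OF this] have "D \<le> c * D" using sums by (simp add: sum_subtractf D_def)
  then have "(1 - c) * D \<le> 0" by (simp add: algebra_simps)
  then have "D \<le> 0" using c by (simp add: mult_le_0_iff)
  then have "D = 0" unfolding D_def by (intro antisym sum_nonneg) auto
  then show ?thesis using \<open>j < n\<close> unfolding D_def by (subst (asm) sum_nonneg_eq_0_iff) auto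
qed

text \<open>With \<open>a\<close> the initial mass, conservation of mass keeps the sum of
  \<open>y k - a * q\<close> at zero. As \<open>a * q\<close> is a fixed point, the contraction
  applies at every step and the error decays geometrically.\<close>

lemma resolvent_iteration_tendsto:
  assumes lam: "0 < lam" "lam < 1"
    and step: "\<And>k. resolvent_step n p lam (y k) (y (Suc k))"
    and q: "\<And>j. j < n \<Longrightarrow> (\<Sum>i<n. q i * p i j) = q j" "(\<Sum>i<n. q i) = 1"
  shows "(\<lambda>k. \<Sum>i<n. \<bar>y k i - (\<Sum>i<n. y 0 i) * q i\<bar>) \<longlonglongrightarrow> 0"
proof -
  obtain c where c: "0 \<le> c" "c < 1" and
    contr: "\<And>y z. resolvent_step n p lam y z \<Longrightarrow> (\<Sum>i<n. y i) = 0 \<Longrightarrow>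
      (\<Sum>i<n. \<bar>z i\<bar>) \<le> c * (\<Sum>i<n. \<bar>y i\<bar>)"
    by (rule resolvent_contraction[OF lam]) auto
  define a where "a = (\<Sum>i<n. y 0 i)"
  define D where "D k = (\<Sum>i<n. \<bar>y k i - a * q i\<bar>)" for k
  have sum: "(\<Sum>i<n. y k i) = a" for k
    by (induction k) (simp_all add: a_def resolvent_sum[OF lam step])
  have "D (Suc k) \<le> c * D k" for k
    unfolding D_def
  proof (rule contr)
    show "resolvent_step n p lam (\<lambda>i. y k i - a * q i) (\<lambda>i. y (Suc k) i - a * q i)"
      by (intro resolvent_step_diff step resolvent_step_invariant q)
    show "(\<Sum>i<n. y k i - a * q i) = 0"
      by (simp add: sum_subtractf sum q flip: sum_distrib_left)
  qed
  then have le: "D k \<le> c ^ k * D 0" for k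
  proof (induction k)
    case (Suc k)
    have "D (Suc k) \<le> c * D k" by (rule Suc)
    also have "\<dots> \<le> c * (c ^ k * D 0)" using Suc c by (intro mult_left_mono) auto
    finally show ?case by (simp add: mult.assoc)
  qed simp
  have "D \<longlonglongrightarrow> 0"
  proof (rule tendsto_sandwich[of "\<lambda>_. 0"])
    show "(\<lambda>k. c ^ k * D 0) \<longlonglongrightarrow> 0"
      using tendsto_mult_right[OF LIMSEQ_realpow_zero[OF c], of "D 0"] by simp
    show "eventually (\<lambda>k. 0 \<le> D k) sequentially"
      by (auto simp: D_def intro!: always_eventually sum_nonneg)
  qed (auto simp: le)
  then show ?thesis by (simp add: D_def[abs_def] a_def)
qed

end

section \<open>Spectral radius and left Perron vector of a stochastic matrix\<close>

lemma index_row_mult: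
  assumes "P \<in> carrier_mat n m" "q \<in> carrier_vec n" "j < m"
  shows "(q \<^sup>T*\<^sub>m P) $ j = (\<Sum>i<n. q $ i * P $$ (i, j))"
  using assms by (auto simp: row_mult_def scalar_prod_def atLeast0LessThan mult.commute intro!: sum.cong)

text \<open>At spectral radius 1 the Perron equation is plain invariance, so Perron vectors are the
  positive invariant distributions of the kernel.\<close>

lemma is_left_perron_vec_stochastic_iff:
  assumes P: "P \<in> carrier_mat n n" and rho: "rho P = 1"
  shows "is_left_perron_vec P q \<longleftrightarrow> q \<in> carrier_vec n \<and>
    (\<forall>j<n. (\<Sum>i<n. q $ i * P $$ (i, j)) = q $ j) \<and> (\<forall>j<n. 0 < q $ j) \<and> (\<Sum>i<n. q $ i) = 1"
proof (cases "q \<in> carrier_vec n")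
  case q: True
  have "q \<^sup>T*\<^sub>m P = rho P \<cdot>\<^sub>v q \<longleftrightarrow> (\<forall>j<n. (q \<^sup>T*\<^sub>m P) $ j = q $ j)"
    using P q rho by (auto simp: vec_eq_iff row_mult_def)
  moreover have "q \<bullet> ones_vec n = (\<Sum>i<n. q $ i)"
    by (simp add: ones_vec_def scalar_prod_def atLeast0LessThan)
  ultimately show ?thesis
    using P q by (simp add: is_left_perron_vec_def positive_vec_def index_row_mult[OF P q])
qed (use P in \<open>simp add: is_left_perron_vec_def\<close>)

lemma (in stochastic) index_complex_mult_vec:
  assumes P: "P \<in> carrier_mat n n" "\<And>i j. i < n \<Longrightarrow> j < n \<Longrightarrow> P $$ (i, j) = p i j"
    and "u \<in> carrier_vec n" "i < n"
  shows "(map_mat complex_of_real P *\<^sub>v u) $ i = (\<Sum>j<n. of_real (p i j) * u $ j)"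
  using assms by (auto simp: scalar_prod_def atLeast0LessThan intro!: sum.cong)

text \<open>The all-ones vector is a right eigenvector, taken over the complex numbers because
  \<open>rho\<close> refers to the complex spectrum.\<close>

lemma (in stochastic) one_in_spectrum:
  assumes "0 < n" and P: "P \<in> carrier_mat n n" "\<And>i j. i < n \<Longrightarrow> j < n \<Longrightarrow> P $$ (i, j) = p i j"
  shows "1 \<in> spectrum (map_mat complex_of_real P)"
proof -
  let ?M = "map_mat complex_of_real P"
  define e where "e = vec n (\<lambda>_. 1 :: complex)"
  have e: "e \<in> carrier_vec n" by (simp add: e_def)
  have e_index: "e $ i = 1" if "i < n" for i using that by (simp add: e_def)
  have "(?M *\<^sub>v e) $ i = e $ i" if "i < n" for i
  proof -
    have "(?M *\<^sub>v e) $ i = (\<Sum>j<n. of_real (p i j) * e $ j)"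
      using index_complex_mult_vec[OF P(1) _ e that] P(2) by blast
    also have "\<dots> = of_real (\<Sum>j<n. p i j)" by (simp add: e_index)
    finally show ?thesis using that by (simp add: row_sum e_index)
  qed
  then have "?M *\<^sub>v e = e" by (intro eq_vecI) (use P(1) e in auto)
  moreover have "e \<noteq> 0\<^sub>v n" using e_index[OF \<open>0 < n\<close>] \<open>0 < n\<close> by auto
  ultimately have "eigenvector ?M e 1" using e P(1) by (simp add: eigenvector_def)
  then show ?thesis unfolding spectrum_def eigenvalue_def by blast
qed

text \<open>At a coordinate \<open>k\<close> where an eigenvector \<open>u\<close> has maximal
  modulus \<open>m\<close>, the eigenvalue equation bounds \<open>norm \<mu> * m\<close> by a
  weighted average of moduli, hence by \<open>m\<close>.\<close>

lemma (in stochastic) norm_spectrum_le_1: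
  assumes "0 < n" and P: "P \<in> carrier_mat n n" "\<And>i j. i < n \<Longrightarrow> j < n \<Longrightarrow> P $$ (i, j) = p i j"
    and "\<mu> \<in> spectrum (map_mat complex_of_real P)"
  shows "norm \<mu> \<le> 1"
proof -
  let ?M = "map_mat complex_of_real P"
  from assms(4) obtain u where u: "u \<in> carrier_vec n" "u \<noteq> 0\<^sub>v n" "?M *\<^sub>v u = \<mu> \<cdot>\<^sub>v u"
    using P(1) by (auto simp: spectrum_def eigenvalue_def eigenvector_def)
  define m where "m = Max ((\<lambda>i. norm (u $ i)) ` {..<n})"
  have m_ge: "norm (u $ i) \<le> m" if "i < n" for i
    unfolding m_def using that by (intro Max_ge) auto
  have "m \<in> (\<lambda>i. norm (u $ i)) ` {..<n}"
    unfolding m_def using \<open>0 < n\<close> by (intro Max_in) auto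
  then obtain k where k: "k < n" "m = norm (u $ k)" by auto
  \<comment> \<open>A nonzero coordinate makes \<open>m\<close> positive, so that it can be
    cancelled.\<close>
  have "\<exists>i<n. u $ i \<noteq> 0"
    using u(1,2) by (metis carrier_vecD eq_vecI index_zero_vec)
  then obtain i where i: "i < n" "u $ i \<noteq> 0" by blast
  have "0 < norm (u $ i)" using i by simp
  also have "\<dots> \<le> m" by (rule m_ge) fact
  finally have "0 < m" .
  have "norm \<mu> * m = norm ((?M *\<^sub>v u) $ k)"
    unfolding u(3) using u(1) k by (simp add: norm_mult)
  also have "(?M *\<^sub>v u) $ k = (\<Sum>j<n. of_real (p k j) * u $ j)"
    using index_complex_mult_vec[OF P(1) _ u(1) k(1)] P(2) by blast
  also have "norm \<dots> \<le> (\<Sum>j<n. p k j * m)"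
  proof (intro order_trans[OF norm_sum] sum_mono)
    fix j assume "j \<in> {..<n}"
    then have "j < n" by simp
    then show "norm (of_real (p k j) * u $ j) \<le> p k j * m"
      using nonneg[OF k(1)] m_ge by (simp add: norm_mult mult_left_mono)
  qed
  also have "\<dots> = m" using k(1) by (simp add: row_sum flip: sum_distrib_right)
  finally show ?thesis using \<open>0 < m\<close> by simp
qed

lemma (in stochastic) rho_eq_1:
  assumes "0 < n" and P: "P \<in> carrier_mat n n" "\<And>i j. i < n \<Longrightarrow> j < n \<Longrightarrow> P $$ (i, j) = p i j"
  shows "rho P = 1"
proof -
  have M: "map_mat complex_of_real P \<in> carrier_mat n n" using P(1) by simp
  from spectral_radius_mem_max(1)[OF M \<open>0 < n\<close>] obtain \<mu>
    where \<mu>: "rho P = norm \<mu>" "\<mu> \<in> spectrum (map_mat complex_of_real P)"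
    unfolding rho_def by blast
  then have "rho P \<le> 1"
    using norm_spectrum_le_1[OF assms(1) P(1) _ \<mu>(2)] P(2) by simp
  moreover have "1 \<in> norm ` spectrum (map_mat complex_of_real P)"
    using one_in_spectrum[OF assms(1) P(1)] P(2) by (metis image_eqI norm_one)
  then have "1 \<le> rho P"
    unfolding rho_def by (rule spectral_radius_mem_max(2)[OF M \<open>0 < n\<close>])
  ultimately show ?thesis by linarith
qed

text \<open>\<open>left_perron_vec\<close> is a definite description, so anything said about it
  rests on unique existence, here inherited from the invariant distribution.\<close>

lemma (in irreducible_stochastic) is_left_perron_vec_left_perron_vec:
  assumes P: "P \<in> carrier_mat n n" "\<And>i j. i < n \<Longrightarrow> j < n \<Longrightarrow> P $$ (i, j) = p i j"
  shows "is_left_perron_vec P (left_perron_vec P)"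
  unfolding left_perron_vec_def
proof (rule theI')
  have "rho P = 1" using rho_eq_1[OF dim_pos P(1)] P(2) by blast
  note left_perron_iff = is_left_perron_vec_stochastic_iff[OF P(1) this]
  have sum_P: "(\<Sum>i<n. q i * P $$ (i, j)) = (\<Sum>i<n. q i * p i j)"
    if "j < n" for q :: "nat \<Rightarrow> real" and j
    using that P(2) by (intro sum.cong) auto
  show "\<exists>!q. is_left_perron_vec P q"
  proof (rule ex_ex1I)
    obtain q where "\<And>j. j < n \<Longrightarrow> (\<Sum>i<n. q i * p i j) = q j" "\<And>j. j < n \<Longrightarrow> 0 < q j"
      "(\<Sum>i<n. q i) = 1" using invariant_distribution_exists by blast
    then have "is_left_perron_vec P (vec n q)" unfolding left_perron_iff by (simp add: sum_P)
    then show "\<exists>q. is_left_perron_vec P q" ..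
  next
    fix q q' assume "is_left_perron_vec P q" "is_left_perron_vec P q'"
    then have q: "q \<in> carrier_vec n" "\<And>j. j < n \<Longrightarrow> (\<Sum>i<n. q $ i * p i j) = q $ j"
        "(\<Sum>i<n. q $ i) = 1"
      and q': "q' \<in> carrier_vec n" "\<And>j. j < n \<Longrightarrow> (\<Sum>i<n. q' $ i * p i j) = q' $ j"
        "(\<Sum>i<n. q' $ i) = 1"
      unfolding left_perron_iff by (simp_all add: sum_P)
    have "q $ j = q' $ j" if "j < n" for j
      using invariant_unique[of "($) q" "($) q'" j] q q' that by simp
    then show "q = q'" using q(1) q'(1) by (intro eq_vecI) auto
  qed
qed

section \<open>From irreducible matrices to irreducible kernels\<close>

lemma index_mult_mat_sum:
  assumes "A \<in> carrier_mat n m" "B \<in> carrier_mat m k" "i < n" "j < k"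
  shows "(A * B) $$ (i, j) = (\<Sum>l<m. A $$ (i, l) * B $$ (l, j))"
  using assms by (simp add: scalar_prod_def atLeast0LessThan)

text \<open>Column \<open>j\<close> of \<open>R\<close> has its only 1 in row \<open>p j\<close>, so
  each of the two products collapses to a single term.\<close>

lemma index_permutation_conjugate:
  fixes A :: "real mat"
  assumes A: "A \<in> carrier_mat n n" and p: "p permutes {..<n}" and ij: "i < n" "j < n"
  defines "R \<equiv> mat n n (\<lambda>(i, j). if i = p j then 1 else 0)"
  shows "(transpose_mat R * A * R) $$ (i, j) = A $$ (p i, p j)"
proof -
  have p_less: "p k < n" if "k < n" for k using permutes_in_image[OF p, of k] that by simp
  have R: "R \<in> carrier_mat n n" by (simp add: R_def)
  have R_entry: "R $$ (l, j) = (if l = p j then 1 else 0)" if "l < n" for l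
    using that ij by (simp add: R_def)
  have left: "(transpose_mat R * A) $$ (i, l) = A $$ (p i, l)" if "l < n" for l
  proof -
    have "(transpose_mat R * A) $$ (i, l) = (\<Sum>k<n. (if k = p i then 1 else 0) * A $$ (k, l))"
      using that A R ij by (simp add: scalar_prod_def atLeast0LessThan R_def)
    also have "\<dots> = (\<Sum>k<n. if k = p i then A $$ (k, l) else 0)" by (intro sum.cong) auto
    finally show ?thesis using p_less[OF ij(1)] by simp
  qed
  have RA: "transpose_mat R * A \<in> carrier_mat n n"
    using A by (intro carrier_matI) (simp_all add: R_def)
  have "(transpose_mat R * A * R) $$ (i, j) =
      (\<Sum>l<n. (transpose_mat R * A) $$ (i, l) * R $$ (l, j))"
    by (rule index_mult_mat_sum[OF RA R ij])
  also have "\<dots> = (\<Sum>l<n. if l = p j then A $$ (p i, l) else 0)"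
    by (intro sum.cong refl) (simp add: left R_entry)
  finally show ?thesis using p_less[OF ij(2)] by simp
qed

text \<open>If no edge left \<open>S\<close>, a simultaneous permutation of rows and columns would
  separate \<open>S\<close> from its complement and exhibit a zero block. This turns the definition
  by permutation matrices into the cut condition \<open>connected\<close>.\<close>

lemma irreducible_mat_connected:
  assumes A: "A \<in> carrier_mat n n" and irr: "irreducible_mat A"
    and S: "S \<subseteq> {..<n}" "S \<noteq> {}" "S \<noteq> {..<n}"
  shows "\<exists>i\<in>S. \<exists>j\<in>{..<n} - S. A $$ (i, j) \<noteq> 0"
proof (rule ccontr)
  assume no_edge: "\<not> (\<exists>i\<in>S. \<exists>j\<in>{..<n} - S. A $$ (i, j) \<noteq> 0)"
  \<comment> \<open>The zero block sits at the lower left, so the permutation lists the complement of \<open>S\<close> first.\<close>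
  define T where "T = {..<n} - S"
  define r s where "r = card T" and "s = card S"
  have fin: "finite S" "finite T" using S(1) finite_subset by (auto simp: T_def)
  have rs: "r + s = n"
    using card_Diff_subset[OF fin(1) S(1)] card_mono[OF _ S(1)] by (simp add: r_def s_def T_def)
  have "T \<noteq> {}" using S by (auto simp: T_def)
  then have r1: "1 \<le> r" and s1: "1 \<le> s"
    using S(2) fin by (simp_all add: r_def s_def Suc_le_eq card_gt_0_iff)
  obtain f where f: "bij_betw f {0..<r} T" using ex_bij_betw_nat_finite[OF fin(2)] r_def by blast
  obtain g where g: "bij_betw g {0..<s} S" using ex_bij_betw_nat_finite[OF fin(1)] s_def by blast
  \<comment> \<open>\<open>f\<close> and \<open>g\<close> enumerate \<open>T\<close> and
    \<open>S\<close> in any order; the last case is the identity outside \<open>{..<n}\<close> that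
    \<open>permutes\<close> demands.\<close>
  define p where "p i = (if i < r then f i else if i < n then g (i - r) else i)" for i
  have "bij_betw p {0..<r} T"
    using f by (subst bij_betw_cong[of _ _ f]) (auto simp: p_def)
  moreover have "bij_betw p {r..<n} S"
  proof -
    have "bij_betw (\<lambda>i. i - r) {r..<n} {0..<s}"
      by (rule bij_betw_byWitness[of _ "\<lambda>i. i + r"]) (use rs in auto)
    from bij_betw_trans[OF this g] show ?thesis
      by (subst bij_betw_cong[of _ _ "g \<circ> (\<lambda>i. i - r)"]) (auto simp: p_def)
  qed
  ultimately have "bij_betw p ({0..<r} \<union> {r..<n}) (T \<union> S)"
    by (rule bij_betw_combine) (auto simp: T_def)
  moreover have "{0..<r} \<union> {r..<n} = {..<n}" "T \<union> S = {..<n}"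
    using rs S(1) by (auto simp: T_def)
  ultimately have perm: "p permutes {..<n}"
    using rs by (intro bij_imp_permutes) (auto simp: p_def)
  have p_T: "p j \<in> T" if "j < r" for j
    using bij_betwE[OF f] that by (simp add: p_def)
  have p_S: "p i \<in> S" if "r \<le> i" "i < n" for i
    using bij_betwE[OF g] that rs by (simp add: p_def)
  define R where "R = mat n n (\<lambda>(i, j). if i = p j then 1 else (0 :: real))"
  define C where "C = transpose_mat R * A * R"
  have C: "C \<in> carrier_mat n n" using A by (intro carrier_matI) (simp_all add: C_def R_def)
  \<comment> \<open>Such a row index is sent into \<open>S\<close> and such a column index into
    \<open>T\<close>, and no edge runs from \<open>S\<close> to \<open>T\<close>.\<close>
  have zero: "C $$ (i, j) = 0" if "r \<le> i" "i < n" "j < r" for i j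
  proof -
    have "C $$ (i, j) = A $$ (p i, p j)"
      unfolding C_def R_def using that rs by (intro index_permutation_conjugate[OF A perm]) auto
    then show ?thesis using no_edge p_S[of i] p_T[of j] that by (auto simp: T_def)
  qed
  have block: "C = four_block_mat (mat r r (\<lambda>(i, j). C $$ (i, j))) (mat r s (\<lambda>(i, j). C $$ (i, j + r)))
      (0\<^sub>m s r) (mat s s (\<lambda>(i, j). C $$ (i + r, j + r)))"
    by (rule eq_matI) (use C rs zero in auto)
  have "reducible_mat A"
    unfolding reducible_mat_def
  proof (intro conjI exI)
    show "square_mat A" using A by simp
    show "1 \<le> r" "1 \<le> s" by fact+
    show "r + s = dim_row A" using A rs by simp
    show "R \<in> carrier_mat (dim_row A) (dim_row A)" using A by (simp add: R_def)
    show "permutation_mat R"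
      unfolding permutation_mat_def using perm by (auto simp: R_def)
    show "transpose_mat R * A * R = four_block_mat (mat r r (\<lambda>(i, j). C $$ (i, j)))
        (mat r s (\<lambda>(i, j). C $$ (i, j + r))) (0\<^sub>m s r) (mat s s (\<lambda>(i, j). C $$ (i + r, j + r)))"
      using block unfolding C_def .
  qed auto
  \<comment> \<open>\<open>irreducible_mat\<close> excludes reducibility from order 2 on, which two
    nonempty blocks guarantee.\<close>
  moreover have "2 \<le> dim_row A" using A r1 s1 rs by simp
  ultimately show False using irr by (auto simp: irreducible_mat_def)
qed

text \<open>Division by positive row sums keeps the zero pattern and thus the edges. Irreducibility
  itself rules out zero rows.\<close>

lemma irreducible_stochastic_row_normalize:
  assumes A: "A \<in> carrier_mat n n" and irr: "irreducible_mat A"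
    and nonneg: "\<And>i j. i < n \<Longrightarrow> j < n \<Longrightarrow> 0 \<le> A $$ (i, j)"
  shows "irreducible_stochastic n (\<lambda>i j. row_normalize A $$ (i, j))"
proof -
  have "0 < n" using irr A by (auto simp: irreducible_mat_def)
  have row_pos: "0 < (\<Sum>k<n. A $$ (i, k))" if "i < n" for i
  proof -
    \<comment> \<open>In order 1 the entry is nonzero by definition; otherwise \<open>{i}\<close> is
      a proper subset and an edge must leave it.\<close>
    have "\<exists>j<n. A $$ (i, j) \<noteq> 0"
    proof (cases "n = 1")
      case True
      then show ?thesis using irr A that by (auto simp: irreducible_mat_def)
    next
      case False
      then have "{i} \<noteq> {..<n}" using card_lessThan[of n] by (metis is_singletonI is_singleton_altdef)
      from irreducible_mat_connected[OF A irr _ _ this] that show ?thesis by auto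
    qed
    then obtain j where "j < n" "A $$ (i, j) \<noteq> 0" by blast
    then show ?thesis
      using nonneg that by (intro sum_pos2[of _ j]) (auto simp: less_le)
  qed
  have P: "row_normalize A $$ (i, j) = A $$ (i, j) / (\<Sum>k<n. A $$ (i, k))"
    if "i < n" "j < n" for i j
    using A that by (simp add: row_normalize_def)
  show ?thesis
  proof
    show "0 \<le> row_normalize A $$ (i, j)" if "i < n" "j < n" for i j
      using that row_pos[of i] by (simp add: P nonneg less_imp_le)
    show "(\<Sum>j<n. row_normalize A $$ (i, j)) = 1" if "i < n" for i
      using that row_pos[of i] by (simp add: P flip: sum_divide_distrib)
    fix S assume S: "S \<subseteq> {..<n}" "S \<noteq> {}" "S \<noteq> {..<n}"
    then obtain i j where "i \<in> S" "j \<in> {..<n} - S" "A $$ (i, j) \<noteq> 0"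
      using irreducible_mat_connected[OF A irr] by blast
    moreover from this S(1) have "i < n" "j < n" by auto
    ultimately show "\<exists>i\<in>S. \<exists>j\<in>{..<n} - S. 0 < row_normalize A $$ (i, j)"
      using row_pos[of i] nonneg[of i j]
      by (intro bexI[of _ i] bexI[of _ j]) (auto simp: P less_le)
  qed fact
qed

section \<open>Block-diagonal matrices\<close>

lemma sum_lessThan_add:
  "(\<Sum>i<m + n. f i) = (\<Sum>i<m. f i) + (\<Sum>i<n. f (m + i))" for f :: "nat \<Rightarrow> 'a :: comm_monoid_add"
  by (induction n) (simp_all add: add.assoc)

lemma index_block_diag:
  assumes "A1 \<in> carrier_mat n1 n1" "A2 \<in> carrier_mat n2 n2" "i < n1 + n2" "j < n1 + n2"
  shows "four_block_mat A1 (0\<^sub>m n1 n2) (0\<^sub>m n2 n1) A2 $$ (i, j) =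
    (if i < n1 then if j < n1 then A1 $$ (i, j) else 0
     else if j < n1 then 0 else A2 $$ (i - n1, j - n1))"
  using assms by auto

lemma row_sum_block_diag:
  fixes A1 A2 :: "real mat"
  assumes A: "A1 \<in> carrier_mat n1 n1" "A2 \<in> carrier_mat n2 n2" and i: "i < n1 + n2"
  shows "(\<Sum>k<n1 + n2. four_block_mat A1 (0\<^sub>m n1 n2) (0\<^sub>m n2 n1) A2 $$ (i, k)) =
    (if i < n1 then \<Sum>k<n1. A1 $$ (i, k) else \<Sum>k<n2. A2 $$ (i - n1, k))"
  unfolding sum_lessThan_add using i
  by (simp add: index_block_diag[OF A i] del: index_mat_four_block)

text \<open>The zero blocks add nothing to a row sum, so each row is divided by the sum within its
  own block.\<close>

lemma row_normalize_block_diag: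
  assumes A: "A1 \<in> carrier_mat n1 n1" "A2 \<in> carrier_mat n2 n2"
  shows "row_normalize (four_block_mat A1 (0\<^sub>m n1 n2) (0\<^sub>m n2 n1) A2) =
    four_block_mat (row_normalize A1) (0\<^sub>m n1 n2) (0\<^sub>m n2 n1) (row_normalize A2)"
proof (rule eq_matI)
  let ?A = "four_block_mat A1 (0\<^sub>m n1 n2) (0\<^sub>m n2 n1) A2"
  fix i j
  assume "i < dim_row (four_block_mat (row_normalize A1) (0\<^sub>m n1 n2) (0\<^sub>m n2 n1) (row_normalize A2))"
    "j < dim_col (four_block_mat (row_normalize A1) (0\<^sub>m n1 n2) (0\<^sub>m n2 n1) (row_normalize A2))"
  then have ij: "i < n1 + n2" "j < n1 + n2" using A by (simp_all add: row_normalize_def)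
  have dims: "row_normalize A1 \<in> carrier_mat n1 n1" "row_normalize A2 \<in> carrier_mat n2 n2"
    using A by (auto simp: row_normalize_def)
  have "row_normalize ?A $$ (i, j) = ?A $$ (i, j) / (\<Sum>k<n1 + n2. ?A $$ (i, k))"
    using A ij by (simp add: row_normalize_def del: index_mat_four_block(1))
  also have "\<dots> = four_block_mat (row_normalize A1) (0\<^sub>m n1 n2) (0\<^sub>m n2 n1) (row_normalize A2) $$ (i, j)"
    unfolding row_sum_block_diag[OF A ij(1)] index_block_diag[OF A ij] index_block_diag[OF dims ij]
    using A ij by (simp add: row_normalize_def)
  finally show "row_normalize ?A $$ (i, j) =
      four_block_mat (row_normalize A1) (0\<^sub>m n1 n2) (0\<^sub>m n2 n1) (row_normalize A2) $$ (i, j)" .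
qed (use A in \<open>simp_all add: row_normalize_def\<close>)

lemma stochastic_block_diag:
  assumes P: "P1 \<in> carrier_mat n1 n1" "P2 \<in> carrier_mat n2 n2"
    and st: "stochastic n1 (\<lambda>i j. P1 $$ (i, j))" "stochastic n2 (\<lambda>i j. P2 $$ (i, j))"
  shows "stochastic (n1 + n2)
    (\<lambda>i j. four_block_mat P1 (0\<^sub>m n1 n2) (0\<^sub>m n2 n1) P2 $$ (i, j))"
proof
  fix i j assume "i < n1 + n2" "j < n1 + n2"
  then show "0 \<le> four_block_mat P1 (0\<^sub>m n1 n2) (0\<^sub>m n2 n1) P2 $$ (i, j)"
    using P stochastic.nonneg[OF st(1)] stochastic.nonneg[OF st(2)] by simp
next
  fix i assume "i < n1 + n2"
  then show "(\<Sum>j<n1 + n2. four_block_mat P1 (0\<^sub>m n1 n2) (0\<^sub>m n2 n1) P2 $$ (i, j)) = 1"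
    unfolding row_sum_block_diag[OF P \<open>i < n1 + n2\<close>]
    using stochastic.row_sum[OF st(1), of i] stochastic.row_sum[OF st(2), of "i - n1"] by simp
qed

text \<open>A column through one block meets only zeros in the rows of the other, so the system
  decouples.\<close>

lemma resolvent_step_block_diag:
  assumes P: "P1 \<in> carrier_mat n1 n1" "P2 \<in> carrier_mat n2 n2"
    and step: "resolvent_step (n1 + n2)
      (\<lambda>i j. four_block_mat P1 (0\<^sub>m n1 n2) (0\<^sub>m n2 n1) P2 $$ (i, j)) lam y z"
  shows "resolvent_step n1 (\<lambda>i j. P1 $$ (i, j)) lam y z"
    and "resolvent_step n2 (\<lambda>i j. P2 $$ (i, j)) lam (\<lambda>i. y (n1 + i)) (\<lambda>i. z (n1 + i))"
proof -
  let ?P = "four_block_mat P1 (0\<^sub>m n1 n2) (0\<^sub>m n2 n1) P2"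
  show "resolvent_step n1 (\<lambda>i j. P1 $$ (i, j)) lam y z"
    unfolding resolvent_step_def
  proof (intro allI impI)
    fix j assume "j < n1"
    have "(\<Sum>i<n1 + n2. z i * ?P $$ (i, j)) = (\<Sum>i<n1. z i * P1 $$ (i, j))"
      using P \<open>j < n1\<close> by (simp add: sum_lessThan_add)
    then show "z j = lam * (\<Sum>i<n1. z i * P1 $$ (i, j)) + (1 - lam) * y j"
      using resolvent_stepD[OF step, of j] \<open>j < n1\<close> by (simp only: trans_less_add1)
  qed
  show "resolvent_step n2 (\<lambda>i j. P2 $$ (i, j)) lam (\<lambda>i. y (n1 + i)) (\<lambda>i. z (n1 + i))"
    unfolding resolvent_step_def
  proof (intro allI impI)
    fix j assume "j < n2"
    have "(\<Sum>i<n1 + n2. z i * ?P $$ (i, n1 + j)) = (\<Sum>i<n2. z (n1 + i) * P2 $$ (i, j))"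
      using P \<open>j < n2\<close> by (simp add: sum_lessThan_add)
    then show "z (n1 + j) = lam * (\<Sum>i<n2. z (n1 + i) * P2 $$ (i, j)) + (1 - lam) * y (n1 + j)"
      using resolvent_stepD[OF step, of "n1 + j"] \<open>j < n2\<close> by (simp only: nat_add_left_cancel_less)
  qed
qed

section \<open>Matrix powers and convergence of the whole sequence\<close>

text \<open>A new transposed factor on the left is a new factor \<open>X\<close> on the right, which
  is how \<open>pow_mat\<close> unfolds.\<close>

lemma row_mult_iterate_pow:
  assumes X: "X \<in> carrier_mat n n" and v: "v \<in> carrier_vec n"
    and x: "x 0 = v" "\<And>k. x (Suc k) = x k \<^sup>T*\<^sub>m X"
  shows "x k = v \<^sup>T*\<^sub>m (X ^\<^sub>m k)"
proof (induction k)
  case 0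
  then show ?case using X v x(1) by (simp add: row_mult_def)
next
  case (Suc k)
  have Xk: "X ^\<^sub>m k \<in> carrier_mat n n" using X by (rule pow_carrier_mat)
  have T: "transpose_mat X \<in> carrier_mat n n" "transpose_mat (X ^\<^sub>m k) \<in> carrier_mat n n"
    using X Xk by simp_all
  have "x (Suc k) = transpose_mat X *\<^sub>v (transpose_mat (X ^\<^sub>m k) *\<^sub>v v)"
    unfolding x(2) Suc row_mult_def ..
  also have "\<dots> = (transpose_mat X * transpose_mat (X ^\<^sub>m k)) *\<^sub>v v"
    by (rule assoc_mult_mat_vec[OF T v, symmetric])
  also have "\<dots> = v \<^sup>T*\<^sub>m (X ^\<^sub>m Suc k)"
    unfolding row_mult_def pow_mat.simps transpose_mult[OF Xk X] ..
  finally show ?case .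
qed

theorem theorem3:
  fixes A A1 A2 :: "real mat" and N n1 n2 :: nat and lam :: real
    and v :: "real vec" and x :: "nat \<Rightarrow> real vec"
  assumes "A1 \<in> carrier_mat n1 n1" and "A2 \<in> carrier_mat n2 n2" and "n1 + n2 = N"
    and "irreducible_mat A1" and "irreducible_mat A2"
    and "A = four_block_mat A1 (0\<^sub>m n1 n2) (0\<^sub>m n2 n1) A2"
    and "nonneg_mat A" and "reducible_mat A"
    and "0 < lam" and "lam < 1"
    and "v \<in> carrier_vec N" and "personalization_vec v" and "norm1_vec v = 1"
    and "x 0 = v" and "\<And>k. k \<ge> 1 \<Longrightarrow> x k = x (k - 1) \<^sup>T*\<^sub>m X_mat A lam"
  shows "(\<forall>k\<ge>1. x k = v \<^sup>T*\<^sub>m (X_mat A lam ^\<^sub>m k)) \<and>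
    (\<exists>\<alpha>1 \<alpha>2. \<alpha>1 \<ge> 0 \<and> \<alpha>2 \<ge> 0 \<and> \<alpha>1 + \<alpha>2 = 1 \<and>
       converges_vec x (\<alpha>1 \<cdot>\<^sub>v left_perron_vec (row_normalize A1)
                     @\<^sub>v \<alpha>2 \<cdot>\<^sub>v left_perron_vec (row_normalize A2)))"
proof -
  note A1 = assms(1) and A2 = assms(2) and N = assms(3) and lam = assms(9,10) and v = assms(11)
  define P1 P2 where "P1 = row_normalize A1" and "P2 = row_normalize A2"
  have P: "P1 \<in> carrier_mat n1 n1" "P2 \<in> carrier_mat n2 n2"
    using A1 A2 by (auto simp: P1_def P2_def row_normalize_def)
  have A_nonneg: "0 \<le> A $$ (i, j)" if "i < n1 + n2" "j < n1 + n2" for i j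
    using assms(7) that A1 A2 unfolding assms(6) nonneg_mat_def less_eq_mat_def by force
  have "0 \<le> A1 $$ (i, j)" if "i < n1" "j < n1" for i j
    using A_nonneg[of i j] that A1 A2 by (simp add: assms(6))
  from irreducible_stochastic_row_normalize[OF A1 assms(4) this]
  interpret P1: irreducible_stochastic n1 "\<lambda>i j. P1 $$ (i, j)" by (simp add: P1_def)
  have "0 \<le> A2 $$ (i, j)" if "i < n2" "j < n2" for i j
    using A_nonneg[of "n1 + i" "n1 + j"] that A1 A2 by (simp add: assms(6))
  from irreducible_stochastic_row_normalize[OF A2 assms(5) this]
  interpret P2: irreducible_stochastic n2 "\<lambda>i j. P2 $$ (i, j)" by (simp add: P2_def)
  define PA where "PA = row_normalize A"
  have PA_eq: "PA = four_block_mat P1 (0\<^sub>m n1 n2) (0\<^sub>m n2 n1) P2"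
    unfolding PA_def P1_def P2_def assms(6) by (rule row_normalize_block_diag[OF A1 A2])
  have PA: "PA \<in> carrier_mat N N" unfolding PA_eq using P N by auto
  interpret PA: stochastic N "\<lambda>i j. PA $$ (i, j)"
    unfolding PA_eq N[symmetric]
    by (rule stochastic_block_diag[OF P P1.stochastic_axioms P2.stochastic_axioms])
  obtain B where B: "mat_inverse (1\<^sub>m N - lam \<cdot>\<^sub>m PA) = Some B" "B \<in> carrier_mat N N" and
    step: "\<And>y. y \<in> carrier_vec N \<Longrightarrow> resolvent_step N (\<lambda>i j. PA $$ (i, j)) lam
      (($) y) (($) (y \<^sup>T*\<^sub>m ((1 - lam) \<cdot>\<^sub>m B)))"
    by (rule PA.mat_inverse_exists[OF lam PA]) auto
  have "dim_row A = N" using A1 A2 N by (simp add: assms(6))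
  then have X_eq: "X_mat A lam = (1 - lam) \<cdot>\<^sub>m B"
    using B(1) by (simp add: X_mat_def PA_def)
  have X: "X_mat A lam \<in> carrier_mat N N" unfolding X_eq using B(2) by simp
  have x_Suc: "x (Suc k) = x k \<^sup>T*\<^sub>m X_mat A lam" for k using assms(15)[of "Suc k"] by simp
  have x_pow: "x k = v \<^sup>T*\<^sub>m (X_mat A lam ^\<^sub>m k)" for k
    by (rule row_mult_iterate_pow[OF X v assms(14) x_Suc])
  have x_carrier: "x k \<in> carrier_vec N" for k
    unfolding x_pow row_mult_def
    by (rule mult_mat_vec_carrier[OF _ v]) (use pow_carrier_mat[OF X] in simp)
  have x_step: "resolvent_step (n1 + n2)
      (\<lambda>i j. four_block_mat P1 (0\<^sub>m n1 n2) (0\<^sub>m n2 n1) P2 $$ (i, j)) lam (($) (x k)) (($) (x (Suc k)))"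
    for k using step[OF x_carrier, of k] unfolding x_Suc X_eq PA_eq N .
  define c1 c2 where "c1 = left_perron_vec P1" and "c2 = left_perron_vec P2"
  \<comment> \<open>Spectral radius 1 lets the Perron vectors be read as invariant
    distributions.\<close>
  have "rho P1 = 1" "rho P2 = 1"
    by (rule P1.rho_eq_1[OF P1.dim_pos P(1) refl]) (rule P2.rho_eq_1[OF P2.dim_pos P(2) refl])
  then have c1: "c1 \<in> carrier_vec n1" "\<And>j. j < n1 \<Longrightarrow> (\<Sum>i<n1. c1 $ i * P1 $$ (i, j)) = c1 $ j"
      "(\<Sum>i<n1. c1 $ i) = 1"
    and c2: "c2 \<in> carrier_vec n2" "\<And>j. j < n2 \<Longrightarrow> (\<Sum>i<n2. c2 $ i * P2 $$ (i, j)) = c2 $ j"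
      "(\<Sum>i<n2. c2 $ i) = 1"
    using P1.is_left_perron_vec_left_perron_vec[OF P(1) refl]
      P2.is_left_perron_vec_left_perron_vec[OF P(2) refl]
    unfolding c1_def[symmetric] c2_def[symmetric]
    by (simp_all only: is_left_perron_vec_stochastic_iff[OF P(1)] is_left_perron_vec_stochastic_iff[OF P(2)])
  \<comment> \<open>Each block conserves its own mass, so the weights of the limit are the masses
    that \<open>v\<close> gives to the two blocks.\<close>
  define a1 a2 where "a1 = (\<Sum>i<n1. v $ i)" and "a2 = (\<Sum>i<n2. v $ (n1 + i))"
  have v_pos: "0 < v $ i" if "i < N" for i
    using assms(12) v that by (simp add: personalization_vec_def positive_vec_def)
  have "0 \<le> a1" "0 \<le> a2"
    unfolding a1_def a2_def using N by (intro sum_nonneg less_imp_le v_pos; simp)+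
  moreover have "a1 + a2 = 1"
  proof -
    have "a1 + a2 = (\<Sum>i<N. v $ i)" unfolding a1_def a2_def N[symmetric] sum_lessThan_add ..
    also have "\<dots> = v \<bullet> ones_vec (dim_vec v)"
      using v by (simp add: ones_vec_def scalar_prod_def atLeast0LessThan)
    finally show ?thesis using assms(12) by (simp add: personalization_vec_def)
  qed
  moreover have "converges_vec x (a1 \<cdot>\<^sub>v c1 @\<^sub>v a2 \<cdot>\<^sub>v c2)"
    unfolding converges_vec_def
  proof (intro conjI allI)
    let ?l = "a1 \<cdot>\<^sub>v c1 @\<^sub>v a2 \<cdot>\<^sub>v c2"
    have dims: "dim_vec c1 = n1" "dim_vec c2 = n2" "dim_vec (x k) = n1 + n2" for k
      using c1(1) c2(1) x_carrier[of k] N by auto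
    then show "dim_vec (x k) = dim_vec ?l" for k by simp
    \<comment> \<open>The norm splits at index \<open>n1\<close>, which leaves one convergence
      statement per block.\<close>
    have "norm1_vec (x k - ?l) = (\<Sum>i<n1. \<bar>x k $ i - a1 * c1 $ i\<bar>) +
        (\<Sum>i<n2. \<bar>x k $ (n1 + i) - a2 * c2 $ i\<bar>)" for k
      unfolding norm1_vec_def by (simp add: dims sum_lessThan_add)
    moreover have "(\<lambda>k. \<Sum>i<n1. \<bar>x k $ i - a1 * c1 $ i\<bar>) \<longlonglongrightarrow> 0"
      using P1.resolvent_iteration_tendsto[where y = "\<lambda>k i. x k $ i" and q = "($) c1",
          OF lam resolvent_step_block_diag(1)[OF P x_step] c1(2,3)]
      by (simp add: assms(14) a1_def)
    moreover have "(\<lambda>k. \<Sum>i<n2. \<bar>x k $ (n1 + i) - a2 * c2 $ i\<bar>) \<longlonglongrightarrow> 0"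
      using P2.resolvent_iteration_tendsto[where y = "\<lambda>k i. x k $ (n1 + i)" and q = "($) c2",
          OF lam resolvent_step_block_diag(2)[OF P x_step] c2(2,3)]
      by (simp add: assms(14) a2_def)
    ultimately show "(\<lambda>k. norm1_vec (x k - ?l)) \<longlonglongrightarrow> 0"
      using tendsto_add by fastforce
  qed
  ultimately show ?thesis
    using x_pow unfolding c1_def c2_def P1_def P2_def by blast
qed

end
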